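(* Let $d>0$, let $f:[0,d)\to\mathbb{R}$ be continuous on $[0,d)$, of class $C^r$ on $(0,d)$ ($r\ge 1$), positive on $(0,d)$, with $f(0)=f'(0)=0$. Assume that $f$ is sublinear, i.e. there exists a constant $m>1$ such that $$m\le x\cdot(\log f)'(x),\qquad x\in(0,d).$$ Put $g=\mathrm{id}-f$ and let $S^g(x_0)=\{x_n\mid n\in\mathbb{N}\}$, $x_{n+1}=g(x_n)$, be an orbit of $g$ with initial point $0<x_0<d$, contained in $(0,d)$ and tending monotonically to $0$. Then $$|A_\varepsilon(S^g(x_0))|\simeq f^{-1}(\varepsilon),\quad\text{as }\varepsilon\to 0.$$
   Context: For a bounded set $U\subset\mathbb{R}$, $|A_\varepsilon(U)|$ denotes the Lebesgue measure (length) of the $\varepsilon$-neighborhood of $U$ in $\mathbb{R}$. For two positive functions $F,G$ defined near $0$ on the positive side, $F(x)\simeq G(x)$ as $x\to0$ means that there exist constants $A,B>0$ and $\delta>0$ such that $A\le F(x)/G(x)\le B$ for all $x\in(0,\delta)$. $f'(0)$ denotes the (right) derivative of $f$ at $0$. The condition $m\le x(\log f)'(x)$ forces $f$ to be strictly increasing, so $f^{-1}(\varepsilon)$ is defined for small $\varepsilon>0$. *)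

theory Defs
  imports "HOL-Analysis.Analysis"
begin

text \<open>
  Class \<open>C\<^sup>r\<close> on \<open>S\<close>. Meant for open \<open>S\<close>, where the iterates of \<^const>\<open>deriv\<close> at points of \<open>S\<close>
  depend only on the values of \<open>f\<close> on \<open>S\<close>.
\<close>

definition class_C_on :: "nat \<Rightarrow> (real \<Rightarrow> real) \<Rightarrow> real set \<Rightarrow> bool" where
  "class_C_on r f S \<longleftrightarrow>
     (\<forall>k<r. (deriv ^^ k) f differentiable_on S) \<and> (\<forall>k\<le>r. continuous_on S ((deriv ^^ k) f))"

definition sublinear_on :: "real \<Rightarrow> (real \<Rightarrow> real) \<Rightarrow> bool" where
  "sublinear_on d f \<longleftrightarrow> (\<exists>m>1. \<forall>x\<in>{0<..<d}. m \<le> x * deriv (\<lambda>t. ln (f t)) x)"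

definition orbit_set :: "('a \<Rightarrow> 'a) \<Rightarrow> 'a \<Rightarrow> 'a set" where
  "orbit_set g x0 = {(g ^^ n) x0 | n. True}"

definition eps_neighborhood :: "real \<Rightarrow> real set \<Rightarrow> real set" where
  "eps_neighborhood \<epsilon> U = (\<Union>u\<in>U. ball u \<epsilon>)"

text \<open>
  Since \<open>F x / 0 = 0\<close>, the positive lower bound \<open>A\<close> also forces \<open>F\<close> and \<open>G\<close> to be nonzero
  on \<open>(0, \<delta>)\<close>.
\<close>

definition comparable_at_0 :: "(real \<Rightarrow> real) \<Rightarrow> (real \<Rightarrow> real) \<Rightarrow> bool" where
  "comparable_at_0 F G \<longleftrightarrow>
     (\<exists>A>0. \<exists>B>0. \<exists>\<delta>>0. \<forall>x\<in>{0<..<\<delta>}. A \<le> F x / G x \<and> F x / G x \<le> B)"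

end

theory Submission
  imports Defs
begin

text \<open>
  Write \<open>x\<^sub>n\<close> for the orbit and \<open>s = f\<^sup>-\<^sup>1(\<epsilon>)\<close>. Integrating \<open>m/x \<le> (ln f)'\<close> shows that
  \<open>f(x)/x\<^sup>m\<close> is nondecreasing (\<open>log_derivative_imp_power_growth\<close>). Hence \<open>f\<close> is strictly increasing,
  \<open>f(x)/x\<close> is nondecreasing, and the gaps of the orbit satisfy
  \<open>x\<^sub>n - x\<^sub>n\<^sub>+\<^sub>1 = f(x\<^sub>n) \<ge> \<epsilon> (x\<^sub>n/s)\<^sup>m\<close> as long as \<open>x\<^sub>n \<ge> s\<close>, while they are at most \<open>\<epsilon>\<close> as soon as
  \<open>x\<^sub>n \<le> s\<close>. The neighborhood thus splits at the height \<open>s\<close>.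

  Below \<open>s\<close> the balls overlap, so they fill the whole interval from \<open>0\<close> to the first orbit point
  \<open>x\<^sub>K \<le> s\<close> (\<open>small_gaps_fill_interval\<close>). Since \<open>x\<^sub>n\<^sub>+\<^sub>1/x\<^sub>n = 1 - f(x\<^sub>n)/x\<^sub>n\<close> is smallest for \<open>n = 0\<close>,
  the orbit cannot jump far below \<open>s\<close>: \<open>x\<^sub>K \<ge> (x\<^sub>1/x\<^sub>0) s\<close>. This is the lower bound.

  Above \<open>s\<close> the balls may be disjoint, and each contributes at most \<open>2\<epsilon>\<close>. There are only few of
  them: the potential \<open>(x\<^sub>n/s)\<^sup>1\<^sup>-\<^sup>m\<close> is at most \<open>1\<close> there, and the bound on the gaps makes it grow by at
  least \<open>(m-1)\<epsilon>/s\<close> in each step (\<open>power_gap_step_count\<close>). So \<open>K\<epsilon> \<le> \<epsilon> + s/(m-1)\<close>, and the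
  total length of these balls is again of order \<open>s\<close>, because \<open>\<epsilon> = f(s) \<le> s\<close>. This is where
  \<open>m > 1\<close> is essential.
\<close>

section \<open>Growth of a function with bounded logarithmic derivative\<close>

text \<open>The function \<open>ln (f t) - m ln t\<close> has nonnegative derivative.\<close>

lemma log_derivative_imp_power_growth:
  fixes f :: "real \<Rightarrow> real"
  assumes diff: "\<And>t. t \<in> {0<..<d} \<Longrightarrow> f differentiable at t"
    and pos: "\<And>t. t \<in> {0<..<d} \<Longrightarrow> f t > 0"
    and log_deriv: "\<And>t. t \<in> {0<..<d} \<Longrightarrow> m \<le> t * deriv (\<lambda>t. ln (f t)) t"
    and "0 < x" "x \<le> y" "y < d"
  shows "f x * (y / x) powr m \<le> f y"
proof -
  have "ln (f x) - m * ln x \<le> ln (f y) - m * ln y"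
  proof (rule DERIV_nonneg_imp_nondecreasing[OF \<open>x \<le> y\<close>])
    fix t assume "x \<le> t" "t \<le> y"
    with assms have t: "t \<in> {0<..<d}" "t > 0" by auto
    from diff[OF t(1)] have "(\<lambda>t. ln (f t)) differentiable at t"
      using pos[OF t(1)] differentiable_compose[of ln f t UNIV]
      by (metis DERIV_ln field_differentiable_def field_differentiable_imp_differentiable)
    then have "((\<lambda>t. ln (f t)) has_real_derivative deriv (\<lambda>t. ln (f t)) t) (at t)"
      using DERIV_deriv_iff_real_differentiable by blast
    then have "((\<lambda>t. ln (f t) - m * ln t) has_real_derivative
        deriv (\<lambda>t. ln (f t)) t - m * (1 / t)) (at t)"
      using DERIV_cmult[OF DERIV_ln_divide[OF t(2)], of m] by (rule DERIV_diff)
    moreover have "0 \<le> deriv (\<lambda>t. ln (f t)) t - m * (1 / t)"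
      using log_deriv[OF t(1)] t(2) by (simp add: field_simps)
    ultimately show "\<exists>D. ((\<lambda>t. ln (f t) - m * ln t) has_real_derivative D) (at t) \<and> 0 \<le> D"
      by blast
  qed
  moreover have "f x > 0" "f y > 0" using pos assms by auto
  ultimately have "ln (f x * (y / x) powr m) \<le> ln (f y)"
    using \<open>0 < x\<close> \<open>x \<le> y\<close> by (simp add: ln_mult ln_powr ln_div algebra_simps)
  then show ?thesis
    using \<open>f x > 0\<close> \<open>f y > 0\<close> assms by simp
qed

section \<open>Counting the steps of an orbit\<close>

text \<open>
  The tangent line bound of the convex function \<open>t\<^sup>-\<^sup>a\<close>. It replaces the integral of
  \<open>a t\<^sup>-\<^sup>a\<^sup>-\<^sup>1\<close> over the gap from \<open>v\<close> to \<open>u\<close>.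
\<close>

lemma powr_minus_tangent_bound:
  fixes u v a :: real
  assumes "0 < u" "0 < v" "0 \<le> a"
  shows "a * u powr (- a - 1) * (u - v) \<le> v powr (- a) - u powr (- a)"
proof -
  have "a * (1 - v / u) \<le> a * - ln (v / u)"
    using assms ln_le_minus_one[of "v / u"] by (intro mult_left_mono) auto
  also have "\<dots> \<le> exp (- a * ln (v / u)) - 1"
    using exp_ge_add_one_self[of "- a * ln (v / u)"] by simp
  also have "exp (- a * ln (v / u)) = (v / u) powr (- a)"
    using assms by (simp add: powr_def)
  finally have "a * (1 - v / u) * u powr (- a) \<le> ((v / u) powr (- a) - 1) * u powr (- a)"
    by (intro mult_right_mono) auto
  also have "\<dots> = v powr (- a) - u powr (- a)"
    using assms by (simp add: powr_divide field_simps)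
  also have "a * (1 - v / u) * u powr (- a) = a * u powr (- a - 1) * (u - v)"
    using assms by (simp add: powr_diff field_simps)
  finally show ?thesis .
qed

text \<open>
  The potential \<open>(x\<^sub>n/s)\<^sup>1\<^sup>-\<^sup>m\<close> lies between \<open>0\<close> and \<open>1\<close> while \<open>x\<^sub>n \<ge> s\<close> and gains at least
  \<open>(m-1)\<epsilon>/s\<close> in each step.
\<close>

lemma power_gap_step_count:
  fixes x :: "nat \<Rightarrow> real"
  assumes "s > 0" "m > 1"
    and above: "\<And>n. n \<le> N \<Longrightarrow> s \<le> x n"
    and gap: "\<And>n. n < N \<Longrightarrow> \<epsilon> * (x n / s) powr m \<le> x n - x (Suc n)"
  shows "real N * \<epsilon> \<le> s / (m - 1)"
proof -
  define u where "u n = x n / s" for n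
  have u_ge_1: "u n \<ge> 1" if "n \<le> N" for n
    using above[OF that] \<open>s > 0\<close> by (simp add: u_def)
  have step: "(m - 1) * \<epsilon> / s \<le> u (Suc n) powr (1 - m) - u n powr (1 - m)" if "n < N" for n
  proof -
    have u: "u n > 0" "u (Suc n) > 0" using u_ge_1[of n] u_ge_1[of "Suc n"] that by auto
    have "u n powr (- m) * u n powr m = 1"
      using u by (simp add: powr_minus)
    then have "(m - 1) * \<epsilon> / s = (m - 1) * u n powr (- m) * (\<epsilon> * u n powr m / s)"
      by (simp add: mult.assoc mult.left_commute)
    also have "\<dots> \<le> (m - 1) * u n powr (- m) * (u n - u (Suc n))"
      using gap[OF that] assms
      by (intro mult_left_mono) (auto simp: u_def diff_divide_distrib[symmetric] divide_right_mono)
    also have "\<dots> \<le> u (Suc n) powr (1 - m) - u n powr (1 - m)"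
      using powr_minus_tangent_bound[OF u, of "m - 1"] \<open>m > 1\<close> by simp
    finally show ?thesis .
  qed
  have "real N * ((m - 1) * \<epsilon> / s) = (\<Sum>n<N. (m - 1) * \<epsilon> / s)" by simp
  also have "\<dots> \<le> (\<Sum>n<N. u (Suc n) powr (1 - m) - u n powr (1 - m))"
    using step by (intro sum_mono) auto
  also have "\<dots> = u N powr (1 - m) - u 0 powr (1 - m)"
    by (rule sum_lessThan_telescope)
  also have "\<dots> \<le> u N powr (1 - m)" by simp
  also have "\<dots> \<le> u N powr 0"
    using u_ge_1[of N] \<open>m > 1\<close> by (intro powr_mono) auto
  also have "\<dots> = 1" using u_ge_1[of N] by simp
  finally show ?thesis using assms by (simp add: field_simps)
qed

section \<open>Neighborhoods of decreasing sequences\<close>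

lemma eps_neighborhood_lmeasurable:
  assumes "bounded U"
  shows "eps_neighborhood \<epsilon> U \<in> lmeasurable"
proof (rule lmeasurable_open)
  obtain a where a: "\<And>u. u \<in> U \<Longrightarrow> \<bar>u\<bar> \<le> a"
    using assms by (auto simp: bounded_iff)
  show "bounded (eps_neighborhood \<epsilon> U)"
    unfolding bounded_iff eps_neighborhood_def
    by (rule exI[of _ "a + \<epsilon>"]) (auto simp: dist_real_def dest!: a)
  show "open (eps_neighborhood \<epsilon> U)"
    unfolding eps_neighborhood_def by auto
qed

text \<open>
  A point \<open>t\<close> below \<open>x\<^sub>N\<close> lies in one of the gaps, whose lower end is then closer to \<open>t\<close> than \<open>\<epsilon>\<close>.
\<close>

lemma small_gaps_fill_interval:
  fixes x :: "nat \<Rightarrow> real"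
  assumes "decseq x" "x \<longlonglongrightarrow> 0"
    and gap: "\<And>n. n \<ge> N \<Longrightarrow> x n - x (Suc n) \<le> \<epsilon>"
  shows "{0<..<x N} \<subseteq> eps_neighborhood \<epsilon> (range x)"
proof
  fix t assume t: "t \<in> {0<..<x N}"
  then have "\<exists>k. x k \<le> t"
    using order_tendstoD(2)[OF \<open>x \<longlonglongrightarrow> 0\<close>, of t]
    by (auto simp: eventually_sequentially intro: less_imp_le)
  then have le: "x (LEAST k. x k \<le> t) \<le> t" by (rule LeastI_ex)
  have "\<not> (LEAST k. x k \<le> t) \<le> N"
    using decseqD[OF \<open>decseq x\<close>, of "LEAST k. x k \<le> t" N] le t by auto
  then obtain k where k: "(LEAST k. x k \<le> t) = Suc k" "k \<ge> N"
    by (metis not_less_eq_eq not0_implies_Suc Suc_le_mono le0)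
  then have "t < x k" using not_less_Least[of k "\<lambda>k. x k \<le> t"] by auto
  then have "dist (x (Suc k)) t < \<epsilon>"
    using gap[OF k(2)] le k(1) by (simp add: dist_real_def)
  then show "t \<in> eps_neighborhood \<epsilon> (range x)"
    unfolding eps_neighborhood_def by auto
qed

text \<open>The points from \<open>x\<^sub>N\<close> on share one interval, and each of the \<open>N\<close> earlier points has its own.\<close>

lemma measure_eps_neighborhood_le:
  fixes x :: "nat \<Rightarrow> real"
  assumes "\<epsilon> > 0" "s \<ge> 0" and tail: "\<And>n. n \<ge> N \<Longrightarrow> x n \<in> {0..s}"
  shows "measure lebesgue (eps_neighborhood \<epsilon> (range x)) \<le> s + 2 * \<epsilon> + real N * (2 * \<epsilon>)"
proof -
  have sub: "eps_neighborhood \<epsilon> (range x) \<subseteq> {-\<epsilon>..s + \<epsilon>} \<union> (\<Union>n<N. ball (x n) \<epsilon>)"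
  proof
    fix t assume "t \<in> eps_neighborhood \<epsilon> (range x)"
    then obtain n where n: "dist (x n) t < \<epsilon>" by (auto simp: eps_neighborhood_def)
    show "t \<in> {-\<epsilon>..s + \<epsilon>} \<union> (\<Union>n<N. ball (x n) \<epsilon>)"
    proof (cases "n < N")
      case False
      then show ?thesis using tail[of n] n by (auto simp: dist_real_def)
    qed (use n in auto)
  qed
  have open_nbhd: "open (eps_neighborhood \<epsilon> (range x))"
    unfolding eps_neighborhood_def by auto
  have balls: "(\<Union>n<N. ball (x n) \<epsilon>) \<in> lmeasurable"
    by (intro fmeasurable.finite_UN) auto
  have "measure lebesgue (eps_neighborhood \<epsilon> (range x))
      \<le> measure lebesgue ({-\<epsilon>..s + \<epsilon>} \<union> (\<Union>n<N. ball (x n) \<epsilon>))"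
    using sub balls open_nbhd by (intro measure_mono_fmeasurable fmeasurable.Un) auto
  also have "\<dots> \<le> measure lebesgue {-\<epsilon>..s + \<epsilon>} + measure lebesgue (\<Union>n<N. ball (x n) \<epsilon>)"
    using balls by (intro measure_Un_le) auto
  also have "measure lebesgue (\<Union>n<N. ball (x n) \<epsilon>) \<le> (\<Sum>n<N. measure lebesgue (ball (x n) \<epsilon>))"
    by (intro measure_UNION_le) auto
  also have "\<dots> = real N * (2 * \<epsilon>)"
    using \<open>\<epsilon> > 0\<close> by (simp add: ball_eq_greaterThanLessThan)
  finally show ?thesis using assms by simp
qed

section \<open>The length of the neighborhood of an orbit\<close>

theorem theorem2:
  fixes d x0 :: real and r :: nat and f g :: "real \<Rightarrow> real"
  assumes "d > 0"
    and "continuous_on {0..<d} f"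
    and "r \<ge> 1"
    and "class_C_on r f {0<..<d}"
    and "\<And>x. x \<in> {0<..<d} \<Longrightarrow> f x > 0"
    and "f 0 = 0"
    and "(f has_real_derivative 0) (at_right 0)"
    and "sublinear_on d f"
    and "g = (\<lambda>x. x - f x)"
    and "0 < x0" and "x0 < d"
    and "orbit_set g x0 \<subseteq> {0<..<d}"
    and "monoseq (\<lambda>n. (g ^^ n) x0)"
    and "(\<lambda>n. (g ^^ n) x0) \<longlonglongrightarrow> 0"
  shows "comparable_at_0
           (\<lambda>\<epsilon>. measure lebesgue (eps_neighborhood \<epsilon> (orbit_set g x0)))
           (\<lambda>\<epsilon>. the_inv_into {0..<d} f \<epsilon>)"
proof -
  obtain m where m: "m > 1" "\<And>x. x \<in> {0<..<d} \<Longrightarrow> m \<le> x * deriv (\<lambda>t. ln (f t)) x"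
    using assms(8) unfolding sublinear_on_def by blast
  have "f differentiable_on {0<..<d}"
    using assms(3,4) unfolding class_C_on_def by (metis funpow_0 less_eq_Suc_le One_nat_def)
  then have diff: "f differentiable at t" if "t \<in> {0<..<d}" for t
    using that by (simp add: differentiable_on_eq_differentiable_at)
  note growth = log_derivative_imp_power_growth[OF diff assms(5) m(2)]
  have ratio_mono: "f a / a \<le> f b / b" if "0 < a" "a \<le> b" "b < d" for a b
  proof -
    have "f a * (b / a) powr 1 \<le> f a * (b / a) powr m"
      using that m(1) assms(5)[of a] by (intro mult_left_mono powr_mono) auto
    also have "\<dots> \<le> f b" using growth that by auto
    finally show ?thesis using that by (simp add: field_simps)
  qed
  have strict: "f a < f b" if "0 \<le> a" "a < b" "b < d" for a b
  proof (cases "a = 0")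
    case True
    then show ?thesis using assms(5)[of b] assms(6) that by auto
  next
    case False
    have "f a * (b / a) \<le> f b" using ratio_mono[of a b] False that by (simp add: field_simps)
    moreover have "f a * 1 < f a * (b / a)"
      using False that assms(5)[of a] by (intro mult_strict_left_mono) auto
    ultimately show ?thesis by simp
  qed
  then have mono: "f a \<le> f b" if "0 \<le> a" "a \<le> b" "b < d" for a b
    using that by (cases "a = b") (auto simp: less_imp_le)
  have inj: "inj_on f {0..<d}"
    using strict by (intro linorder_inj_onI) (auto, metis less_irrefl)

  define x where "x n = (g ^^ n) x0" for n
  have orbit: "orbit_set g x0 = range x"
    by (auto simp: orbit_set_def x_def)
  have x_range: "0 < x n" "x n < d" for n
    using assms(12) rangeI[of x n] unfolding orbit by (meson greaterThanLessThan_iff subsetD)+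
  have x_Suc: "x (Suc n) = x n - f (x n)" for n
    by (simp add: x_def assms(9))
  have f_x_pos: "f (x n) > 0" for n using assms(5) x_range by simp
  have dec: "decseq x"
    using f_x_pos x_Suc by (intro decseq_SucI) (simp add: less_imp_le)
  have lim: "x \<longlonglongrightarrow> 0" using assms(14) by (simp add: x_def[abs_def])
  have x_0: "x 0 = x0" by (simp add: x_def)
  have bdd: "bounded (range x)" using lim by (metis convergentI convergent_imp_bounded)
  have drop: "x 1 / x 0 * x n \<le> x (Suc n)" for n
  proof -
    have "f (x n) / x n \<le> f (x 0) / x 0"
      using decseqD[OF dec, of 0 n] x_range by (intro ratio_mono) auto
    then have "f (x n) \<le> f (x 0) / x 0 * x n"
      using x_range[of n] by (simp add: pos_divide_le_eq)
    moreover have "x 1 / x 0 = 1 - f (x 0) / x 0"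
      using x_Suc[of 0] x_range[of 0] by (simp add: diff_divide_distrib)
    ultimately show ?thesis using x_Suc[of n] by (simp add: left_diff_distrib)
  qed

  define A where "A = x 1 / x 0"
  define B where "B = 5 + 2 / (m - 1)"
  have "A > 0" using x_range by (simp add: A_def)
  moreover have "B > 0" using m(1) by (simp add: B_def add_pos_pos)
  moreover have "f x0 > 0" using assms(5,10,11) by simp
  moreover have "A \<le> measure lebesgue (eps_neighborhood \<epsilon> (orbit_set g x0)) / the_inv_into {0..<d} f \<epsilon>
      \<and> measure lebesgue (eps_neighborhood \<epsilon> (orbit_set g x0)) / the_inv_into {0..<d} f \<epsilon> \<le> B"
    if eps: "\<epsilon> \<in> {0<..<f x0}" for \<epsilon>
  proof -
    have "continuous_on {0..x0} f"
      using assms(2,11) by (auto intro: continuous_on_subset)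
    then obtain s where s: "0 \<le> s" "s \<le> x0" "f s = \<epsilon>"
      using IVT'[of f 0 \<epsilon> x0] eps assms(6,10) by auto
    have s_bounds: "0 < s" "s < x0"
      using s eps assms(6) by (auto simp: less_le)
    then have s_d: "s < d" using assms(11) by simp
    have inv: "the_inv_into {0..<d} f \<epsilon> = s"
      using the_inv_into_f_f[OF inj, of s] s s_d by simp
    have eps_le: "\<epsilon> \<le> s"
    proof -
      have "\<epsilon> / s \<le> f (x 0) / x 0"
        using ratio_mono[of s x0] s s_bounds assms(11) by (simp add: x_0)
      also have "\<dots> \<le> 1" using x_Suc[of 0] x_range[of 0] x_range[of "Suc 0"] by simp
      finally show ?thesis using s_bounds by simp
    qed

    \<comment> \<open>The last orbit point above \<open>s\<close> is \<open>x N\<close>; it exists because \<open>s < x 0\<close>.\<close>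
    define K where "K = (LEAST k. x k \<le> s)"
    have "\<exists>k. x k \<le> s"
      using order_tendstoD(2)[OF lim s_bounds(1)]
      by (auto simp: eventually_sequentially intro: less_imp_le)
    then have K: "x K \<le> s" unfolding K_def by (rule LeastI_ex)
    then have "K \<noteq> 0" using s_bounds x_0 by (intro notI) simp
    then obtain N where N: "K = Suc N" using not0_implies_Suc by blast
    have above: "s < x n" if "n \<le> N" for n
      using not_less_Least[of n "\<lambda>k. x k \<le> s"] that N unfolding K_def by auto
    have below: "x n \<le> s" if "n \<ge> Suc N" for n
      using decseqD[OF dec that] K N by simp

    have "A * s \<le> A * x N" using above[of N] \<open>A > 0\<close> by simp
    also have "\<dots> \<le> x (Suc N)" using drop by (simp add: A_def)
    also have "\<dots> = measure lebesgue {0<..<x (Suc N)}"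
      using x_range[of "Suc N"] by simp
    also have "\<dots> \<le> measure lebesgue (eps_neighborhood \<epsilon> (range x))"
    proof (intro measure_mono_fmeasurable small_gaps_fill_interval dec lim)
      show "x n - x (Suc n) \<le> \<epsilon>" if "n \<ge> Suc N" for n
        using mono[of "x n" s] below[OF that] x_range[of n] s_d s(3) x_Suc[of n] by simp
    qed (use eps_neighborhood_lmeasurable[OF bdd] in auto)
    finally have lower: "A * s \<le> measure lebesgue (eps_neighborhood \<epsilon> (range x))" .

    have count: "real N * \<epsilon> \<le> s / (m - 1)"
    proof (rule power_gap_step_count[OF s_bounds(1) m(1)])
      show "s \<le> x n" if "n \<le> N" for n using above[OF that] by simp
      show "\<epsilon> * (x n / s) powr m \<le> x n - x (Suc n)" if "n < N" for n
      proof -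
        have "f s * (x n / s) powr m \<le> f (x n)"
          using s_bounds above[of n] x_range[of n] that by (intro growth) auto
        then show ?thesis using s(3) x_Suc[of n] by simp
      qed
    qed
    have "measure lebesgue (eps_neighborhood \<epsilon> (range x)) \<le> s + 2 * \<epsilon> + real (Suc N) * (2 * \<epsilon>)"
      using eps s_bounds below x_range
      by (intro measure_eps_neighborhood_le) (auto simp: less_imp_le)
    also have "\<dots> = s + 4 * \<epsilon> + 2 * (real N * \<epsilon>)" by (simp add: algebra_simps)
    also have "\<dots> \<le> 5 * s + 2 * (s / (m - 1))" using count eps_le by linarith
    also have "\<dots> = B * s" by (simp add: B_def algebra_simps)
    finally have "measure lebesgue (eps_neighborhood \<epsilon> (range x)) \<le> B * s" .
    with lower show ?thesis
      unfolding orbit inv using s_bounds(1) by (simp add: pos_le_divide_eq pos_divide_le_eq)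
  qed
  ultimately show ?thesis
    unfolding comparable_at_0_def by blast
qed

end
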